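(* Let $h_{12}:\{\texttt{0},\texttt{1},\texttt{2},\texttt{3},\texttt{4}\}^*\to\{\texttt{0},\texttt{1}\}^*$ be the morphism $h_{12}(\texttt{0})=\texttt{0011}$, $h_{12}(\texttt{1})=\texttt{01}$, $h_{12}(\texttt{2})=\texttt{001}$, $h_{12}(\texttt{3})=\texttt{011}$, $h_{12}(\texttt{4})=\varepsilon$. Every bi-infinite binary word whose only overlap factor is $\texttt{01010}$ and which contains at most 12 distinct squares as factors has the same set of finite factors as $h_{12}(b_5)$.
   Context: $\varepsilon$ is the empty word. $b_5$ is the fixed point starting with $\texttt{0}$ of the morphism $\texttt{0}\mapsto\texttt{01}$, $\texttt{1}\mapsto\texttt{23}$, $\texttt{2}\mapsto\texttt{4}$, $\texttt{3}\mapsto\texttt{21}$, $\texttt{4}\mapsto\texttt{0}$. A square is a nonempty word $uu$. An overlap is a word $u^nv$ with $u$ nonempty, $v$ a prefix of $u$, and $|u^nv|/|u|>2$. *)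

theory Defs
  imports Complex_Main "HOL-Library.Sublist"
begin

datatype letter = A0 | A1 | A2 | A3 | A4

datatype bit = B0 | B1

definition morph :: "('a \<Rightarrow> 'b list) \<Rightarrow> 'a list \<Rightarrow> 'b list" where
  "morph h w = concat (map h w)"

(* The image of a right-infinite word: its n-th letter is read off the image of any prefix of w
   that is long enough (see morph_inf_nth).  The value is only meaningful at positions n that are
   covered by the image of some prefix; for the two uses below all positions are covered. *)
definition morph_inf :: "('a \<Rightarrow> 'b list) \<Rightarrow> (nat \<Rightarrow> 'a) \<Rightarrow> nat \<Rightarrow> 'b" where
  "morph_inf h w n =
    morph h (map w [0..<(LEAST k. n < length (morph h (map w [0..<k])))]) ! n"

fun f5 :: "letter \<Rightarrow> letter list" where
  "f5 A0 = [A0, A1]"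
| "f5 A1 = [A2, A3]"
| "f5 A2 = [A4]"
| "f5 A3 = [A2, A1]"
| "f5 A4 = [A0]"

definition b5 :: "nat \<Rightarrow> letter" where
  "b5 = (THE w. w 0 = A0 \<and> morph_inf f5 w = w)"

fun h12 :: "letter \<Rightarrow> bit list" where
  "h12 A0 = [B0, B0, B1, B1]"
| "h12 A1 = [B0, B1]"
| "h12 A2 = [B0, B0, B1]"
| "h12 A3 = [B0, B1, B1]"
| "h12 A4 = []"

definition square :: "'a list \<Rightarrow> bool" where
  "square x \<longleftrightarrow> (\<exists>u. u \<noteq> [] \<and> x = u @ u)"

definition overlap :: "'a list \<Rightarrow> bool" where
  "overlap x \<longleftrightarrow> (\<exists>u n v. u \<noteq> [] \<and> prefix v u \<and> x = concat (replicate n u) @ v \<and>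
     real (length x) / real (length u) > 2)"

definition factors_inf :: "(nat \<Rightarrow> 'a) \<Rightarrow> 'a list set" where
  "factors_inf w = {map (\<lambda>k. w (i + k)) [0..<n] | i n. True}"

definition factors_biinf :: "(int \<Rightarrow> 'a) \<Rightarrow> 'a list set" where
  "factors_biinf w = {map (\<lambda>k. w (i + int k)) [0..<n] | i n. True}"

lemma morph_simps [simp]:
  "morph h [] = []"
  "morph h (x # xs) = h x @ morph h xs"
  "morph h (xs @ ys) = morph h xs @ morph h ys"
  by (simp_all add: morph_def)

lemma morph_inf_nth:
  assumes "n < length (morph h (map w [0..<k]))"
  shows "morph_inf h w n = morph h (map w [0..<k]) ! n"
proof -
  define j where "j = (LEAST k. n < length (morph h (map w [0..<k])))"
  have j: "n < length (morph h (map w [0..<j]))"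
    unfolding j_def by (rule LeastI) (rule assms)
  have "j \<le> k"
    unfolding j_def by (rule Least_le) (rule assms)
  then have "[0..<k] = [0..<j] @ [j..<k]"
    by (metis le0 le_add_diff_inverse upt_add_eq_append)
  then show ?thesis
    using j unfolding morph_inf_def j_def[symmetric] by (simp add: nth_append)
qed

definition f5_iter :: "nat \<Rightarrow> letter list" where
  "f5_iter m = (morph f5 ^^ m) [A0]"

lemma f5_iter_simps [simp]:
  "f5_iter 0 = [A0]"
  "f5_iter (Suc m) = morph f5 (f5_iter m)"
  by (simp_all add: f5_iter_def)

lemma length_morph_f5: "length w \<le> length (morph f5 w)"
proof (induction w)
  case (Cons a w)
  then show ?case by (cases a) auto
qed simp

lemma f5_iter_Cons: "\<exists>r. f5_iter m = A0 # r"
  by (induction m) auto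

lemma length_f5_iter: "m < length (f5_iter m)"
proof (induction m)
  case (Suc m)
  obtain r where r: "f5_iter m = A0 # r"
    using f5_iter_Cons by blast
  show ?case
    using Suc length_morph_f5[of r] by (simp add: r)
qed simp

lemma prefix_morph: "prefix u v \<Longrightarrow> prefix (morph h u) (morph h v)"
  by (auto simp: prefix_def)

lemma prefix_f5_iter_Suc: "prefix (f5_iter m) (f5_iter (Suc m))"
  by (induction m) (auto simp: prefix_morph)

lemma prefix_f5_iter: "m \<le> k \<Longrightarrow> prefix (f5_iter m) (f5_iter k)"
proof (induction k rule: dec_induct)
  case (step k)
  then show ?case
    using prefix_f5_iter_Suc prefix_order.trans by blast
qed simp

lemma f5_iter_nth_eq:
  assumes "n < length (f5_iter m)" "n < length (f5_iter k)"
  shows "f5_iter m ! n = f5_iter k ! n"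
proof (cases "m \<le> k")
  case True
  then show ?thesis
    using prefix_f5_iter[of m k] assms by (auto simp: prefix_def nth_append)
next
  case False
  then show ?thesis
    using prefix_f5_iter[of k m] assms by (auto simp: prefix_def nth_append)
qed

lemma f5_fixed_point_prefix:
  assumes "w 0 = A0" "morph_inf f5 w = w"
  shows "map w [0..<length (f5_iter m)] = f5_iter m"
proof (induction m)
  case 0
  then show ?case using assms by simp
next
  case (Suc m)
  show ?case
  proof (rule nth_equalityI)
    fix n
    assume "n < length (map w [0..<length (f5_iter (Suc m))])"
    then have "n < length (morph f5 (map w [0..<length (f5_iter m)]))"
      by (simp add: Suc)
    then have "morph_inf f5 w n = morph f5 (map w [0..<length (f5_iter m)]) ! n"
      by (rule morph_inf_nth)
    then show "map w [0..<length (f5_iter (Suc m))] ! n = f5_iter (Suc m) ! n"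
      using \<open>n < length (map w _)\<close> by (simp add: Suc assms)
  qed simp
qed

lemma ex1_f5_fixed_point: "\<exists>!w. w 0 = A0 \<and> morph_inf f5 w = w"
proof (rule ex_ex1I)
  define c where "c n = f5_iter n ! n" for n
  have c: "map c [0..<length (f5_iter m)] = f5_iter m" for m
    by (rule nth_equalityI) (auto simp: c_def intro: f5_iter_nth_eq length_f5_iter)
  have "morph_inf f5 c n = c n" for n
  proof -
    have n: "n < length (f5_iter (Suc n))"
      using length_f5_iter[of "Suc n"] by linarith
    then have "n < length (morph f5 (map c [0..<length (f5_iter n)]))"
      by (simp add: c)
    then have "morph_inf f5 c n = f5_iter (Suc n) ! n"
      using morph_inf_nth[of n f5 c "length (f5_iter n)"] by (simp add: c)
    also have "\<dots> = c n"
      unfolding c_def using n length_f5_iter by (rule f5_iter_nth_eq)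
    finally show ?thesis .
  qed
  then show "\<exists>w. w 0 = A0 \<and> morph_inf f5 w = w"
    by (intro exI[of _ c]) (auto simp: c_def)
next
  fix v w :: "nat \<Rightarrow> letter"
  assume *: "v 0 = A0 \<and> morph_inf f5 v = v" "w 0 = A0 \<and> morph_inf f5 w = w"
  have "v n = w n" for n
  proof -
    have "map v [0..<length (f5_iter n)] = map w [0..<length (f5_iter n)]"
      using * by (simp add: f5_fixed_point_prefix)
    then show ?thesis
      using length_f5_iter[of n] by simp
  qed
  then show "v = w" by blast
qed

lemma b5_fixed_point: "b5 0 = A0" "morph_inf f5 b5 = b5"
  using theI'[OF ex1_f5_fixed_point] unfolding b5_def by auto

lemma length_h12_f5: "length w \<le> length (morph h12 (morph f5 (morph f5 (morph f5 w))))"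
proof (induction w)
  case (Cons a w)
  then show ?case by (cases a) auto
qed simp

lemma h12_b5_infinite: "\<exists>k. n < length (morph h12 (map b5 [0..<k]))"
proof -
  have "length (f5_iter n) \<le> length (morph h12 (f5_iter (Suc (Suc (Suc n)))))"
    using length_h12_f5 by simp
  then have "n < length (morph h12 (f5_iter (Suc (Suc (Suc n)))))"
    using length_f5_iter[of n] by linarith
  then show ?thesis
    using f5_fixed_point_prefix[OF b5_fixed_point] by metis
qed

end

theory Submission
  imports Defs
begin

text \<open>
  Let \<open>L\<close> be the set of factors of \<open>w\<close>. Extending \<open>01010\<close> to the left letter by letter and
  recording the squares that appear, every branch runs into a forbidden overlap or a 13th square,
  unless it has met exactly the 12 squares of \<open>h\<^sub>1\<^sub>2(b\<^sub>5)\<close>. Hence \<open>w\<close> has precisely these 12 squares.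

  The return words of \<open>0011\<close> in \<open>L\<close> are then the five images under \<open>h\<^sub>1\<^sub>2 \<circ> f\<^sub>5\<^sup>3\<close>, so \<open>w\<close> is the
  image of a word over five letters. That word is square-free, because none of the 12 squares has a
  root that starts with \<open>00\<close>, and its factors of length 4 are factors of \<open>b\<^sub>5\<close>. Both properties
  survive desubstitution by \<open>f\<^sub>5\<close>, which can therefore be repeated for ever: every factor shrinks to
  one of length at most 2, which is a factor of \<open>b\<^sub>5\<close>, and every iterate \<open>f\<^sub>5\<^sup>n(0)\<close> occurs.
\<close>

section \<open>Extendable factorial languages\<close>

text \<open>What the argument uses of the factor set of a bi-infinite word. Preimages under a
  morphism are again such sets, so no bi-infinite preimage has to be built.\<close>

definition language :: "'a list set \<Rightarrow> bool" where
  "language L \<longleftrightarrow> [] \<in> L \<and> (\<forall>x\<in>L. \<forall>y. sublist y x \<longrightarrow> y \<in> L) \<and> (\<forall>x\<in>L. \<exists>a b. a # x @ [b] \<in> L)"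

lemma language_sublist: "language L \<Longrightarrow> x \<in> L \<Longrightarrow> sublist y x \<Longrightarrow> y \<in> L"
  by (auto simp: language_def)

lemma language_append:
  assumes "language L" "u @ x @ v \<in> L"
  shows "x \<in> L"
  using assms language_sublist by (metis sublist_appendI)

lemma language_Cons:
  assumes "language L" "x \<in> L"
  obtains a where "a # x \<in> L"
proof -
  obtain a b where "a # x @ [b] \<in> L"
    using assms by (auto simp: language_def)
  then have "a # x \<in> L"
    using language_append[OF assms(1), of "[]" "a # x" "[b]"] by simp
  then show ?thesis by (rule that)
qed

lemma language_extend_left:
  assumes "language L" "x \<in> L"
  obtains u where "length u = n" "u @ x \<in> L"
proof -
  have "\<exists>u. length u = n \<and> u @ x \<in> L"
  proof (induction n)
    case (Suc n)
    then obtain u where "length u = n" "u @ x \<in> L" by blast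
    moreover obtain a where "a # u @ x \<in> L"
      using language_Cons[OF assms(1)] \<open>u @ x \<in> L\<close> by metis
    ultimately show ?case by (intro exI[of _ "a # u"]) auto
  qed (use assms in auto)
  then show ?thesis using that by blast
qed

lemma language_extend_right:
  assumes "language L" "x \<in> L"
  obtains u where "length u = n" "x @ u \<in> L"
proof -
  have "\<exists>u. length u = n \<and> x @ u \<in> L"
  proof (induction n)
    case (Suc n)
    then obtain u where u: "length u = n" "x @ u \<in> L" by blast
    then obtain a b where "a # (x @ u) @ [b] \<in> L"
      using assms(1) by (auto simp: language_def)
    then have "x @ u @ [b] \<in> L"
      using language_append[OF assms(1), of "[a]" "x @ u @ [b]" "[]"] by simp
    then show ?case using u by (intro exI[of _ "u @ [b]"]) auto
  qed (use assms in auto)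
  then show ?thesis using that by blast
qed

section \<open>Search for squares and overlaps\<close>

text \<open>
  The search runs in the simplifier. Its equations therefore avoid \<open>if\<close> and \<open>case\<close> in favour of
  functions that match on an evaluated argument: a rewrite step then does not traverse the long
  words that it only passes on.

  A square \<open>uu\<close> is represented by its root \<open>u\<close>. A search state \<open>Some K\<close> lists the roots found so far;
  \<open>None\<close> is a closed branch, where a forbidden overlap or more than 12 squares occurred or 12
  squares with roots in the target list \<open>T\<close> were found.
\<close>

type_synonym roots = "bit list list"

datatype match = Mismatch | Square | Overlap

text \<open>Meant for \<open>t = drop p y\<close>. In a square of period \<open>p > 0\<close>,
  \<open>y ! p\<close> repeats the first letter of the root, so if it also equals
  \<open>t ! p\<close>, the square extends to an overlap.\<close>

definition compare :: "nat \<Rightarrow> bit list \<Rightarrow> bit list \<Rightarrow> match" where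
  "compare p y t =
    (if p \<le> length y \<and> p \<le> length t \<and> take p y = take p t
     then if p < length y \<and> p < length t \<and> y ! p = t ! p then Overlap else Square
     else Mismatch)"

lemma compare_rules:
  "compare (Suc n) (B0 # x) (B0 # y) = compare n x y"
  "compare (Suc n) (B1 # x) (B1 # y) = compare n x y"
  "compare (Suc n) (B0 # x) (B1 # y) = Mismatch"
  "compare (Suc n) (B1 # x) (B0 # y) = Mismatch"
  "compare (Suc n) x [] = Mismatch"
  "compare 0 (B0 # x) (B0 # y) = Overlap"
  "compare 0 (B1 # x) (B1 # y) = Overlap"
  "compare 0 (B0 # x) (B1 # y) = Square"
  "compare 0 (B1 # x) (B0 # y) = Square"
  "compare 0 x [] = Square"
  by (auto simp: compare_def)

definition same :: "bit list \<Rightarrow> bit list \<Rightarrow> bool" where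
  "same x y \<longleftrightarrow> x = y"

lemma same_rules:
  "same (B0 # x) (B0 # y) = same x y"
  "same (B1 # x) (B1 # y) = same x y"
  "same (B0 # x) (B1 # y) = False"
  "same (B1 # x) (B0 # y) = False"
  "same [] [] = True"
  "same (a # x) [] = False"
  "same [] (a # x) = False"
  by (auto simp: same_def)

fun member_or :: "bool \<Rightarrow> bit list \<Rightarrow> roots \<Rightarrow> bool" where
  "member_or True q K = True"
| "member_or False q [] = False"
| "member_or False q (r # K) = member_or (same q r) q K"

fun subset_and :: "bool \<Rightarrow> roots \<Rightarrow> roots \<Rightarrow> bool" where
  "subset_and False K T = False"
| "subset_and True [] T = True"
| "subset_and True (q # K) T = subset_and (member_or False q T) K T"

fun longer :: "'a list \<Rightarrow> nat \<Rightarrow> bool" where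
  "longer [] n = False"
| "longer (x # xs) 0 = True"
| "longer (x # xs) (Suc n) = longer xs n"

text \<open>The flags say that \<open>K\<close> has at least 12 and more than 12 elements.\<close>

fun admit :: "bool \<Rightarrow> bool \<Rightarrow> roots \<Rightarrow> roots \<Rightarrow> roots option" where
  "admit False b T K = Some K"
| "admit True True T K = None"
| "admit True False T K = (if subset_and True K T then None else Some K)"

fun insert_root :: "bool \<Rightarrow> bit list \<Rightarrow> roots \<Rightarrow> roots \<Rightarrow> roots option" where
  "insert_root True q T K = Some K"
| "insert_root False q T K = admit (longer (q # K) 11) (longer (q # K) 12) T (q # K)"

text \<open>A word of length 5 with period 2 that starts with \<open>0\<close> is
  \<open>01010\<close> or \<open>00000\<close>; accepting the latter is harmless, as it only leaves
  a branch open.\<close>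

fun allowed_overlap :: "nat \<Rightarrow> bit list \<Rightarrow> bool" where
  "allowed_overlap p y \<longleftrightarrow> p = 2 \<and> y \<noteq> [] \<and> hd y = B0"

lemma allowed_overlap_rules:
  "allowed_overlap (Suc 0) y = False"
  "allowed_overlap (Suc (Suc 0)) (B0 # y) = True"
  "allowed_overlap (Suc (Suc 0)) (B1 # y) = False"
  "allowed_overlap (Suc (Suc (Suc n))) y = False"
  by auto

fun record_overlap :: "bool \<Rightarrow> nat \<Rightarrow> bit list \<Rightarrow> roots \<Rightarrow> roots \<Rightarrow> roots option" where
  "record_overlap True p y T K = insert_root (member_or False (take p y) K) (take p y) T K"
| "record_overlap False p y T K = None"

fun record_match :: "match \<Rightarrow> nat \<Rightarrow> bit list \<Rightarrow> roots \<Rightarrow> roots option \<Rightarrow> roots option" where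
  "record_match m p y T None = None"
| "record_match Mismatch p y T (Some K) = Some K"
| "record_match Square p y T (Some K) = insert_root (member_or False (take p y) K) (take p y) T K"
| "record_match Overlap p y T (Some K) = record_overlap (allowed_overlap p y) p y T K"

datatype instr = Move nat | Test nat | Guard

fun starts_11 :: "bit list \<Rightarrow> bool" where
  "starts_11 (B1 # B1 # x) = True"
| "starts_11 x = False"

text \<open>
  Both extensions \<open>0x\<close> and \<open>1x\<close> are tested in one pass, with states \<open>R0\<close> and \<open>R1\<close>. When \<open>Test p\<close> is
  reached, \<open>t\<close> is \<open>x\<close> without its first \<open>p - 1\<close> letters, so only the extension by the first letter
  of \<open>t\<close> can begin with a square of period \<open>p\<close>.
\<close>

fun scan :: "instr list \<Rightarrow> roots \<Rightarrow> bit list \<Rightarrow> bit list \<Rightarrow> roots option \<Rightarrow> roots option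
    \<Rightarrow> roots option \<times> roots option" where
  "scan [] T x t R0 R1 = (R0, R1)"
| "scan (Move g # is) T x t R0 R1 = scan is T x (drop g t) R0 R1"
| "scan (Guard # is) T x t R0 R1 = (if starts_11 x then scan is T x t R0 R1 else (R0, R1))"
| "scan (Test p # is) T x [] R0 R1 = (R0, R1)"
| "scan (Test p # is) T x (B0 # t) R0 R1 =
    scan is T x (B0 # t) (record_match (compare p (B0 # x) (B0 # t)) p (B0 # x) T R0) R1"
| "scan (Test p # is) T x (B1 # t) R0 R1 =
    scan is T x (B1 # t) R0 (record_match (compare p (B1 # x) (B1 # t)) p (B1 # x) T R1)"

lemma scan_rules:
  "scan [] T x t R0 R1 = (R0, R1)"
  "scan (Test (Suc 0) # is) T x (B0 # t) R0 R1 =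
    scan is T x (B0 # t) (record_match (compare (Suc 0) (B0 # x) (B0 # t)) (Suc 0) (B0 # x) T R0) R1"
  "scan (Test (Suc 0) # is) T x (B1 # t) R0 R1 =
    scan is T x (B1 # t) R0 (record_match (compare (Suc 0) (B1 # x) (B1 # t)) (Suc 0) (B1 # x) T R1)"
  "scan (Guard # is) T (B1 # B1 # x) t R0 R1 = scan is T (B1 # B1 # x) t R0 R1"
  "scan (Guard # is) T (B1 # B0 # x) t R0 R1 = (R0, R1)"
  "scan (Guard # is) T (B0 # x) t R0 R1 = (R0, R1)"
  "scan (Move (Suc (Suc g)) # is) T x (a # t) R0 R1 = scan (Move (Suc g) # is) T x t R0 R1"
  by simp_all

lemma scan_Nil: "scan is T x [] R0 R1 = (R0, R1)"
proof (induction "is")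
  case (Cons i "is") then show ?case by (cases i) auto
qed simp

text \<open>A \<open>Move\<close> is merged with the \<open>Test\<close> after it, so that a
  mismatch in the second letter skips the test at once.\<close>

lemma scan_test_rules:
  "scan (Move (Suc 0) # Test (Suc (Suc p)) # is) T (B0 # x) (a # b # B1 # t) R0 R1 =
    scan is T (B0 # x) (b # B1 # t) R0 R1"
  "scan (Move (Suc 0) # Test (Suc (Suc p)) # is) T (B1 # x) (a # b # B0 # t) R0 R1 =
    scan is T (B1 # x) (b # B0 # t) R0 R1"
  "scan (Move (Suc 0) # Test (Suc (Suc p)) # is) T (B0 # x) (a # B0 # B0 # t) R0 R1 =
    scan is T (B0 # x) (B0 # B0 # t)
      (record_match (compare p x t) (Suc (Suc p)) (B0 # B0 # x) T R0) R1"
  "scan (Move (Suc 0) # Test (Suc (Suc p)) # is) T (B0 # x) (a # B1 # B0 # t) R0 R1 =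
    scan is T (B0 # x) (B1 # B0 # t) R0
      (record_match (compare p x t) (Suc (Suc p)) (B1 # B0 # x) T R1)"
  "scan (Move (Suc 0) # Test (Suc (Suc p)) # is) T (B1 # x) (a # B0 # B1 # t) R0 R1 =
    scan is T (B1 # x) (B0 # B1 # t)
      (record_match (compare p x t) (Suc (Suc p)) (B0 # B1 # x) T R0) R1"
  "scan (Move (Suc 0) # Test (Suc (Suc p)) # is) T (B1 # x) (a # B1 # B1 # t) R0 R1 =
    scan is T (B1 # x) (B1 # B1 # t) R0
      (record_match (compare p x t) (Suc (Suc p)) (B1 # B1 # x) T R1)"
proof -
  have [simp]: "record_match Mismatch q y T R = R" for q y R by (cases R) auto
  show "scan (Move (Suc 0) # Test (Suc (Suc p)) # is) T (B0 # x) (a # b # B1 # t) R0 R1 =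
    scan is T (B0 # x) (b # B1 # t) R0 R1"
    by (cases b) (auto simp: compare_rules)
  show "scan (Move (Suc 0) # Test (Suc (Suc p)) # is) T (B1 # x) (a # b # B0 # t) R0 R1 =
    scan is T (B1 # x) (b # B0 # t) R0 R1"
    by (cases b) (auto simp: compare_rules)
qed (simp_all add: compare_rules)

lemma scan_end_rules:
  "scan (Move (Suc 0) # Test (Suc (Suc p)) # is) T x [a, b] R0 R1 = scan is T x [b] R0 R1"
  "scan (Move (Suc 0) # Test (Suc (Suc p)) # is) T x [a] R0 R1 = (R0, R1)"
  "scan (Move g # is) T x [] R0 R1 = (R0, R1)"
proof -
  have [simp]: "record_match Mismatch q y T R = R" for q y R by (cases R) auto
  show "scan (Move (Suc 0) # Test (Suc (Suc p)) # is) T x [a, b] R0 R1 = scan is T x [b] R0 R1"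
    by (cases b) (auto simp: compare_rules)
qed (simp_all add: scan_Nil)

text \<open>The number is fuel: it bounds how many letters a branch may gain before it must be
  closed.\<close>

fun search :: "nat \<Rightarrow> instr list \<Rightarrow> roots \<Rightarrow> bit list \<Rightarrow> roots option \<Rightarrow> bool"
  and search_both :: "nat \<Rightarrow> instr list \<Rightarrow> roots \<Rightarrow> bit list \<Rightarrow> roots option \<times> roots option \<Rightarrow> bool" where
  "search n is T x None = True"
| "search 0 is T x (Some K) = False"
| "search (Suc n) is T x (Some K) = search_both n is T x (scan is T x x (Some K) (Some K))"
| "search_both n is T x (R0, R1) = (search n is T (B0 # x) R0 \<and> search n is T (B1 # x) R1)"

fun plan :: "nat \<Rightarrow> nat list \<Rightarrow> instr list" where
  "plan m [] = []"
| "plan m (p # ps) = Move (p - m) # Test p # plan p ps"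

definition roots12 :: roots where
  "roots12 = [[B0], [B1], [B0,B1], [B1,B0], [B0,B1,B0], [B1,B0,B0,B1], [B0,B1,B1,B0],
    [B1,B0,B1,B0,B0,B1], [B0,B1,B1,B0,B0,B1], [B1,B0,B0,B1,B1,B0], [B1,B0,B0,B1,B0,B1],
    [B1,B0,B0,B1,B0,B1,B1,B0,B0,B1,B1,B0,B1,B0,B0,B1]]"

section \<open>Soundness of the search\<close>

lemma longer_iff: "longer xs n \<longleftrightarrow> n < length xs"
  by (induction xs n rule: longer.induct) auto

lemma member_or_iff: "member_or b q K \<longleftrightarrow> b \<or> q \<in> set K"
  by (induction b q K rule: member_or.induct) (auto simp: same_def)

lemma subset_and_iff: "subset_and b K T \<longleftrightarrow> b \<and> set K \<subseteq> set T"
  by (induction b K T rule: subset_and.induct) (auto simp: member_or_iff)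

lemma overlap_take:
  assumes "0 < p" "2 * p < length y" "take p y = take p (drop p y)" "y ! p = y ! (2 * p)"
  shows "overlap (take (2 * p + 1) y)"
proof -
  define u where "u = take p y"
  have u: "length u = p" "u \<noteq> []" using assms by (auto simp: u_def)
  have "take (2 * p) y = take p y @ take p (drop p y)"
    by (metis mult_2 take_add)
  then have "take (2 * p) y = u @ u"
    using assms by (simp add: u_def)
  moreover have "y ! 0 = drop p y ! 0"
    using assms by (metis nth_take)
  then have "y ! (2 * p) = u ! 0"
    using assms by (simp add: u_def)
  ultimately have "take (2 * p + 1) y = concat (replicate 2 u) @ [u ! 0]"
    using assms by (simp add: take_Suc_conv_app_nth numeral_2_eq_2)
  moreover have "prefix [u ! 0] u"
    using u by (cases u) auto
  moreover have "real (length (take (2 * p + 1) y)) / real (length u) > 2"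
    using assms u by (simp add: field_simps)
  ultimately show ?thesis
    unfolding overlap_def using u(2) by blast
qed

text \<open>\<open>m\<close> counts the letters dropped from \<open>x\<close>. At
  \<open>Test p\<close> it must be \<open>p - 1\<close>, because the comparison concerns
  \<open>x\<close> with one letter prepended.\<close>

fun plan_ok :: "nat \<Rightarrow> instr list \<Rightarrow> bool" where
  "plan_ok m [] = True"
| "plan_ok m (Move g # is) = plan_ok (m + g) is"
| "plan_ok m (Test p # is) = (p = Suc m \<and> plan_ok m is)"
| "plan_ok m (Guard # is) = plan_ok m is"

locale few_squares =
  fixes L :: "bit list set"
  assumes language: "language L"
    and overlaps: "\<And>x. x \<in> L \<Longrightarrow> overlap x \<Longrightarrow> x = [B0, B1, B0, B1, B0]"
    and finite_roots: "finite {u. u \<noteq> [] \<and> u @ u \<in> L}"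
    and card_roots: "card {u. u \<noteq> [] \<and> u @ u \<in> L} \<le> 12"
begin

definition roots :: "bit list set" where
  "roots = {u. u \<noteq> [] \<and> u @ u \<in> L}"

text \<open>A branch closed by a contradiction has left \<open>L\<close>, so a closed branch within
  \<open>L\<close> has found twelve target roots. This is the claim attached to \<open>None\<close>;
  for \<open>T = []\<close> it is false.\<close>

fun sound :: "bit list list \<Rightarrow> bit list list option \<Rightarrow> bool" where
  "sound T None \<longleftrightarrow> (\<exists>K. distinct K \<and> length K = 12 \<and> set K \<subseteq> set T \<inter> roots)"
| "sound T (Some K) \<longleftrightarrow> distinct K \<and> set K \<subseteq> roots"

lemma length_le_12: "distinct K \<Longrightarrow> set K \<subseteq> roots \<Longrightarrow> length K \<le> 12"
  using card_mono[of roots "set K"] finite_roots card_roots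
  by (simp add: roots_def distinct_card)

lemma sound_insert_root:
  assumes "sound T (Some K)" "q \<in> roots"
  shows "sound T (insert_root (member_or False q K) q T K)"
proof (cases "q \<in> set K")
  case False
  then have "distinct (q # K)" "set (q # K) \<subseteq> roots" using assms by auto
  \<comment> \<open>A 13th root is impossible, so \<open>None\<close> can only come from twelve
    roots within \<open>T\<close>.\<close>
  moreover from this have "length (q # K) \<le> 12" by (rule length_le_12)
  ultimately show ?thesis using False
    by (cases "10 < length K")
      (auto simp: member_or_iff longer_iff subset_and_iff intro!: exI[of _ "q # K"])
qed (use assms in \<open>simp add: member_or_iff\<close>)

lemma sound_record_match:
  assumes "sound T R" "y \<in> L" "t = drop p y" "0 < p"
  shows "sound T (record_match (compare p y t) p y T R)"
proof (cases R)
  case (Some K)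
  have root: "take p y \<in> roots" if "compare p y t \<noteq> Mismatch"
  proof -
    have *: "p \<le> length y" "p \<le> length t" "take p y = take p t"
      using that by (auto simp: compare_def split: if_splits)
    then have "y = (take p y @ take p y) @ drop p t"
      using assms by (metis append_assoc append_take_drop_id)
    then have "take p y @ take p y \<in> L"
      using assms language_append[OF language, of "[]"] by (metis append_Nil)
    then show ?thesis using * assms by (auto simp: roots_def)
  qed
  show ?thesis
  proof (cases "compare p y t")
    case Overlap
    show ?thesis
    proof (cases "allowed_overlap p y")
      case False
      have *: "2 * p < length y" "take p y = take p (drop p y)" "y ! p = y ! (2 * p)"
        using Overlap assms by (auto simp: compare_def split: if_splits) (simp add: mult_2)
      then have "overlap (take (2 * p + 1) y)"
        using assms overlap_take by blast
      moreover have "take (2 * p + 1) y \<in> L"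
        using assms language_append[OF language, of "[]"] by (metis append_Nil append_take_drop_id)
      ultimately have eq: "take (2 * p + 1) y = [B0, B1, B0, B1, B0]"
        using overlaps by blast
      then have "length (take (2 * p + 1) y) = 5" by simp
      then have "p = 2" using * by simp
      moreover have "y \<noteq> []" "hd y = B0" using eq by (cases y; auto)+
      ultimately show ?thesis using False by auto
    qed (use Some Overlap root assms sound_insert_root in \<open>auto simp del: sound.simps insert_root.simps\<close>)
  qed (use Some root assms sound_insert_root in \<open>auto simp del: sound.simps insert_root.simps\<close>)
qed (use assms in auto)

lemma sound_scan:
  assumes "plan_ok m is" "t = drop m x" "B0 # x \<in> L \<Longrightarrow> sound T R0" "B1 # x \<in> L \<Longrightarrow> sound T R1"
  shows "(B0 # x \<in> L \<longrightarrow> sound T (fst (scan is T x t R0 R1))) \<and>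
    (B1 # x \<in> L \<longrightarrow> sound T (snd (scan is T x t R0 R1)))"
  using assms
proof (induction "is" T x t R0 R1 arbitrary: m rule: scan.induct)
  case (2 g "is" T x t R0 R1)
  then show ?case by (simp add: add.commute)
next
  case (5 p "is" T x t R0 R1)
  have p: "0 < p" "plan_ok m is" "B0 # t = drop p (B0 # x)"
    using "5.prems"(1,2) by auto
  have "B0 # x \<in> L \<Longrightarrow> sound T (record_match (compare p (B0 # x) (B0 # t)) p (B0 # x) T R0)"
    using sound_record_match[OF _ _ p(3,1)] "5.prems"(3) by blast
  from "5.IH"[OF p(2) "5.prems"(2) this "5.prems"(4)] show ?case unfolding scan.simps by blast
next
  case (6 p "is" T x t R0 R1)
  have p: "0 < p" "plan_ok m is" "B1 # t = drop p (B1 # x)"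
    using "6.prems"(1,2) by auto
  have "B1 # x \<in> L \<Longrightarrow> sound T (record_match (compare p (B1 # x) (B1 # t)) p (B1 # x) T R1)"
    using sound_record_match[OF _ _ p(3,1)] "6.prems"(4) by blast
  from "6.IH"[OF p(2) "6.prems"(2,3) this] show ?case unfolding scan.simps by blast
qed auto

text \<open>Every word of \<open>L\<close> has a left extension in \<open>L\<close>, so some path of
  the search stays in \<open>L\<close>; as all paths close, it ends in a sound
  \<open>None\<close>.\<close>

lemma sound_search:
  assumes "search n is T x R" "plan_ok 0 is" "x \<in> L" "sound T R"
  shows "sound T None"
  using assms
proof (induction n arbitrary: x R)
  case 0
  then show ?case by (cases R) auto
next
  case (Suc n)
  show ?case
  proof (cases R)
    case (Some K)
    obtain R0 R1 where R: "scan is T x x (Some K) (Some K) = (R0, R1)" by fastforce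
    then have "search n is T (B0 # x) R0" "search n is T (B1 # x) R1"
      using Suc.prems(1) Some by auto
    moreover have "B0 # x \<in> L \<longrightarrow> sound T R0" "B1 # x \<in> L \<longrightarrow> sound T R1"
      using sound_scan[of 0 "is" x x T "Some K" "Some K"] R Suc.prems Some by auto
    moreover obtain a where "a # x \<in> L" using language_Cons[OF language] Suc.prems by metis
    ultimately show ?thesis using Suc.IH Suc.prems by (cases a) blast+
  qed (use Suc.prems in simp)
qed

end

section \<open>The twelve squares\<close>

text \<open>
  The periods are those that close branches in an experimental run of the search. The long ones
  matter rarely, so they are only tested if the word starts with \<open>11\<close>. The plan is cut into
  constants, which are unfolded late in order to keep the terms small.
\<close>

definition long_plan :: "instr list" where
  "long_plan = plan 27 [32, 37, 38, 39, 41, 42, 50, 63, 67, 71, 118]"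

definition middle_plan :: "instr list" where
  "middle_plan = plan 9 [12, 16, 17, 23, 24, 27] @ Guard # long_plan"

definition full_plan :: "instr list" where
  "full_plan = Test 1 # plan 1 [2, 3, 4, 5, 6, 8, 9] @ middle_plan"

lemma constant_rules:
  "scan full_plan T x t R0 R1 = scan (Test 1 # plan 1 [2, 3, 4, 5, 6, 8, 9] @ middle_plan) T x t R0 R1"
  "scan middle_plan T x t R0 R1 = scan (plan 9 [12, 16, 17, 23, 24, 27] @ Guard # long_plan) T x t R0 R1"
  "scan long_plan T x t R0 R1 = scan (plan 27 [32, 37, 38, 39, 41, 42, 50, 63, 67, 71, 118]) T x t R0 R1"
  "member_or b q roots12 = member_or b q
    [[B0], [B1], [B0,B1], [B1,B0], [B0,B1,B0], [B1,B0,B0,B1], [B0,B1,B1,B0],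
    [B1,B0,B1,B0,B0,B1], [B0,B1,B1,B0,B0,B1], [B1,B0,B0,B1,B1,B0], [B1,B0,B0,B1,B0,B1],
    [B1,B0,B0,B1,B0,B1,B1,B0,B0,B1,B1,B0,B1,B0,B0,B1]]"
  "longer roots12 10 = True" "longer roots12 11 = True"
  by (simp_all only: full_plan_def middle_plan_def long_plan_def roots12_def)
    (simp_all add: numeral_eq_Suc)

lemmas unary = plan.simps append_Cons append_Nil eval_nat_numeral BitM.simps One_nat_def
  diff_Suc_Suc diff_zero

lemmas evaluation_rules = constant_rules[unfolded unary] insert_root.simps[unfolded unary]
  admit.simps if_True if_False
  compare_rules same_rules member_or.simps subset_and.simps longer.simps allowed_overlap_rules
  record_overlap.simps record_match.simps scan_rules scan_test_rules scan_end_rules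
  take_Suc_Cons take_0

lemma plan_ok_full_plan: "plan_ok 0 full_plan"
  by (simp add: full_plan_def middle_plan_def long_plan_def)

text \<open>The initial roots are those of \<open>0101\<close> and \<open>1010\<close>, the squares
  inside \<open>01010\<close>. The depth bound 360 suffices to close every branch.\<close>

lemma search_01010: "search 360 full_plan roots12 [B0,B1,B0,B1,B0] (Some [[B0,B1],[B1,B0]])"
  by (simp only: evaluation_rules search.simps search_both.simps unary simp_thms)

context few_squares
begin

text \<open>The search yields twelve distinct words that lie in both sets. Neither set has more than
  twelve elements, so each consists of these words.\<close>

lemma roots_eq:
  assumes "[B0, B1, B0, B1, B0] \<in> L"
  shows "roots = set roots12"
proof -
  have "[B0, B1] \<in> roots" "[B1, B0] \<in> roots"
    using language_append[OF language, of "[]" "[B0, B1, B0, B1]" "[B0]"]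
      language_append[OF language, of "[B0]" "[B1, B0, B1, B0]" "[]"] assms
    by (auto simp: roots_def)
  then have "sound roots12 (Some [[B0, B1], [B1, B0]])" by simp
  then obtain K where K: "distinct K" "length K = 12" "set K \<subseteq> set roots12" "set K \<subseteq> roots"
    using sound_search[OF search_01010 plan_ok_full_plan assms] by auto
  have "card (set K) = 12" using K by (simp add: distinct_card)
  moreover have "card (set roots12) \<le> 12" using card_length[of roots12] by (simp add: roots12_def)
  moreover have "finite roots" "card roots \<le> 12" using finite_roots card_roots by (simp_all add: roots_def)
  ultimately show ?thesis
    using K card_seteq[of roots "set K"] card_seteq[of "set roots12" "set K"] by simp
qed

end

section \<open>Desubstitution\<close>

text \<open>
  The words of \<open>M\<close> mark the places where the images of letters begin.
\<close>

definition preimage :: "('a \<Rightarrow> 'b list) \<Rightarrow> 'b list set \<Rightarrow> 'b list set \<Rightarrow> 'a list set" where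
  "preimage g M L = {y. \<exists>m\<in>M. morph g y @ m \<in> L}"

text \<open>Parsing with bounded context: \<open>N\<close> letters beside a marker suffice to
  recognise an image there. Such conditions can be established by checking finitely many short
  words.\<close>

locale desubstitution =
  fixes L :: "'b list set" and g :: "'a \<Rightarrow> 'b list" and M :: "'b list set" and N :: nat
  assumes language: "language L"
    and marker: "\<exists>m\<in>M. prefix m (g a)"
    and nonempty: "[] \<notin> M"
    and parse_left: "u @ m \<in> L \<Longrightarrow> m \<in> M \<Longrightarrow> N \<le> length u \<Longrightarrow> \<exists>a. suffix (g a) u"
    and parse_right: "m @ u \<in> L \<Longrightarrow> m \<in> M \<Longrightarrow> N \<le> length u \<Longrightarrow>
      \<exists>a. \<exists>m'\<in>M. prefix (g a @ m') (m @ u)"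
    and occurs: "u \<in> L \<Longrightarrow> N \<le> length u \<Longrightarrow> \<exists>m\<in>M. sublist m u"
begin

lemma image_nonempty: "g a \<noteq> []"
  using marker[of a] nonempty by auto

lemma morph_nonempty: "y \<noteq> [] \<Longrightarrow> morph g y \<noteq> []"
  using image_nonempty by (cases y) auto

text \<open>Cutting a word after this marker keeps the form required by \<open>preimage\<close>,
  which makes the preimage closed under factors.\<close>

lemma starts_with_marker:
  assumes "m \<in> M"
  obtains m' s where "m' \<in> M" "morph g y @ m = m' @ s"
proof (cases y)
  case Nil
  then show ?thesis using that[of m "[]"] assms by simp
next
  case (Cons a z)
  obtain m' where "m' \<in> M" "prefix m' (g a)" using marker by blast
  then show ?thesis using that Cons by (auto simp: prefix_def)
qed

lemma parse_left_morph:
  assumes "v @ morph g y @ m \<in> L" "m \<in> M" "N \<le> length v"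
  shows "\<exists>a. suffix (g a) v"
proof -
  obtain m' s where "m' \<in> M" "morph g y @ m = m' @ s"
    using starts_with_marker[OF assms(2)] by metis
  moreover from this have "v @ m' \<in> L"
    using language_append[OF language, of "[]" "v @ m'" s] assms by simp
  ultimately show ?thesis using parse_left assms(3) by blast
qed

lemma preimage_Cons:
  assumes "y \<in> preimage g M L"
  obtains a where "a # y \<in> preimage g M L"
proof -
  obtain m where m: "m \<in> M" "morph g y @ m \<in> L"
    using assms by (auto simp: preimage_def)
  obtain u where u: "length u = N" "u @ morph g y @ m \<in> L"
    using language_extend_left[OF language m(2)] by blast
  then obtain a where "suffix (g a) u"
    using parse_left_morph m by blast
  then obtain v where "u = v @ g a" by (auto simp: suffix_def)
  then have "g a @ morph g y @ m \<in> L"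
    using language_append[OF language, of v "g a @ morph g y @ m" "[]"] u by simp
  then show ?thesis using that[of a] m by (auto simp: preimage_def)
qed

lemma preimage_snoc:
  assumes "y \<in> preimage g M L"
  obtains a where "y @ [a] \<in> preimage g M L"
proof -
  obtain m where m: "m \<in> M" "morph g y @ m \<in> L"
    using assms by (auto simp: preimage_def)
  obtain u where u: "length u = N" "(morph g y @ m) @ u \<in> L"
    using language_extend_right[OF language m(2)] by blast
  then have "m @ u \<in> L"
    using language_append[OF language, of "morph g y" "m @ u" "[]"] by simp
  then obtain a m' where am: "m' \<in> M" "prefix (g a @ m') (m @ u)"
    using parse_right u m by blast
  then obtain s where "m @ u = g a @ m' @ s" by (auto simp: prefix_def)
  then have "morph g (y @ [a]) @ m' \<in> L"
    using language_append[OF language, of "[]" "morph g y @ g a @ m'" s] u by simp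
  then show ?thesis using that[of a] am by (auto simp: preimage_def)
qed

lemma preimage_append:
  assumes "u @ y @ v \<in> preimage g M L"
  shows "y \<in> preimage g M L"
proof -
  obtain m where m: "m \<in> M" "morph g u @ morph g y @ morph g v @ m \<in> L"
    using assms by (auto simp: preimage_def)
  moreover obtain m' s where m': "m' \<in> M" "morph g v @ m = m' @ s"
    using starts_with_marker[OF m(1)] by metis
  ultimately have "morph g y @ m' \<in> L"
    using language_append[OF language, of "morph g u" "morph g y @ m'" s] by simp
  then show ?thesis using m' by (auto simp: preimage_def)
qed

lemma language_preimage: "language (preimage g M L)"
  unfolding language_def
proof (intro conjI ballI allI impI)
  obtain u where "length u = N" "[] @ u \<in> L"
    using language_extend_right[OF language] language by (metis language_def)
  then obtain m where "m \<in> M" "m \<in> L"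
    using occurs[of u] language_sublist[OF language] by auto
  then show "[] \<in> preimage g M L" by (auto simp: preimage_def)
next
  fix y z assume "y \<in> preimage g M L" "sublist z y"
  then show "z \<in> preimage g M L"
    using preimage_append by (auto simp: sublist_def)
next
  fix y assume "y \<in> preimage g M L"
  then obtain b where "y @ [b] \<in> preimage g M L" by (rule preimage_snoc)
  then obtain a where "a # y @ [b] \<in> preimage g M L" by (rule preimage_Cons)
  then show "\<exists>a b. a # y @ [b] \<in> preimage g M L" by blast
qed

text \<open>Images are split off the right end of \<open>v\<close> until nothing is left or one
  image covers the rest.\<close>

lemma suffix_cover:
  assumes "v @ morph g y @ m \<in> L" "m \<in> M"
  shows "\<exists>z. z @ y \<in> preimage g M L \<and> suffix v (morph g z)"
  using assms(1)
proof (induction "length v" arbitrary: v y rule: less_induct)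
  case less
  show ?case
  proof (cases "v = []")
    case True
    then show ?thesis using less.prems assms(2) by (intro exI[of _ "[]"]) (auto simp: preimage_def)
  next
    case False
    \<comment> \<open>The added letters give \<open>parse_left\<close> its context even when
      \<open>v\<close> is short.\<close>
    obtain u where u: "length u = N" "u @ v @ morph g y @ m \<in> L"
      using language_extend_left[OF language less.prems] by blast
    then obtain a where "suffix (g a) (u @ v)"
      using parse_left_morph[of "u @ v"] assms(2) by auto
    then consider "suffix v (g a)" | v' where "v = v' @ g a"
      by (metis suffix_append suffix_def)
    then show ?thesis
    proof cases
      case 1
      obtain s where "u @ v = s @ g a" using \<open>suffix (g a) (u @ v)\<close> by (auto simp: suffix_def)
      then have "g a @ morph g y @ m \<in> L"
        using language_append[OF language, of s "g a @ morph g y @ m" "[]"] u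
        by (metis append.right_neutral append_assoc)
      then show ?thesis using 1 assms(2) by (intro exI[of _ "[a]"]) (auto simp: preimage_def)
    next
      case 2
      moreover have "length v' < length v"
        using 2 image_nonempty by simp
      moreover have "v' @ morph g (a # y) @ m \<in> L"
        using less.prems 2 by simp
      ultimately obtain z where "z @ a # y \<in> preimage g M L" "suffix v' (morph g z)"
        using less.hyps by blast
      then show ?thesis using 2 by (intro exI[of _ "z @ [a]"]) (auto simp: suffix_def)
    qed
  qed
qed

lemma cover:
  assumes "x \<in> L"
  obtains y where "y \<in> preimage g M L" "sublist x (morph g y)"
proof -
  obtain u where u: "length u = N" "x @ u \<in> L"
    using language_extend_right[OF language assms] by blast
  then have "u \<in> L" using language_append[OF language, of x u "[]"] by simp
  then obtain m where "m \<in> M" "sublist m u"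
    using occurs u by blast
  then obtain p s where "u = p @ m @ s" by (auto simp: sublist_def)
  then have "(x @ p) @ morph g [] @ m \<in> L"
    using language_append[OF language, of "[]" "x @ p @ m" s] u by simp
  then obtain z where "z \<in> preimage g M L" "suffix (x @ p) (morph g z)"
    using suffix_cover[OF _ \<open>m \<in> M\<close>, of "x @ p" "[]"] by auto
  then show ?thesis
    using that by (auto simp: suffix_def sublist_def)
qed

lemma square_preimage:
  assumes "u @ u \<in> preimage g M L" "u \<noteq> []"
  shows "morph g u \<noteq> []" "morph g u @ morph g u \<in> L"
proof -
  obtain m where "morph g u @ morph g u @ m \<in> L"
    using assms by (auto simp: preimage_def)
  then show "morph g u @ morph g u \<in> L"
    using language_append[OF language, of "[]" "morph g u @ morph g u" m] by simp
qed (use morph_nonempty assms in blast)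

lemma morph_preimage:
  assumes "y \<in> preimage g M L"
  shows "morph g y \<in> L"
  using assms language_append[OF language, of "[]" "morph g y"] by (auto simp: preimage_def)

end

section \<open>Languages that look like the factors of the fixed point\<close>

text \<open>
  \<open>quads\<close> lists the factors of length 4 of \<open>b\<^sub>5\<close>; \<open>candidates\<close> adds the words that a finite check of
  their images does not exclude.
\<close>

definition quads :: "letter list list" where
  "quads = [[A0,A1,A0,A4], [A0,A1,A2,A3], [A0,A4,A2,A1], [A0,A4,A2,A3], [A1,A0,A1,A2],
    [A1,A0,A4,A2], [A1,A2,A3,A0], [A1,A2,A3,A4], [A2,A1,A0,A1], [A2,A1,A0,A4], [A2,A3,A0,A1],
    [A2,A3,A4,A2], [A3,A0,A1,A0], [A3,A0,A1,A2], [A3,A4,A2,A1], [A4,A2,A1,A0], [A4,A2,A3,A0]]"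

definition candidates :: "letter list list" where
  "candidates = quads @ [[A1,A0,A1,A4], [A2,A1,A2,A3], [A3,A0,A1,A4], [A3,A4,A2,A3],
    [A4,A2,A1,A4], [A4,A2,A3,A4], [A0,A1,A0,A1], [A1,A0,A1,A0]]"

text \<open>An invariant of desubstitution by \<open>f5\<close>, strong enough to determine the
  language: it can only be the factor set of \<open>b5\<close>.\<close>

definition b5_like :: "letter list set \<Rightarrow> bool" where
  "b5_like L \<longleftrightarrow> language L \<and> (\<forall>u. u \<noteq> [] \<longrightarrow> u @ u \<notin> L) \<and> (\<forall>x\<in>L. length x = 4 \<longrightarrow> x \<in> set quads)"

lemma length_4: "length x = 4 \<longleftrightarrow> (\<exists>a b c d. x = [a, b, c, d])"
  by (auto simp: numeral_eq_Suc length_Suc_conv)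

text \<open>A word of length 4 in \<open>L\<close> shares three letters with a predecessor and with
  a successor; candidates without such neighbours drop out.\<close>

lemma candidates_extendable:
  "list_all (\<lambda>x. list_ex (\<lambda>z. butlast x = tl z) candidates \<and> list_ex (\<lambda>z. tl x = butlast z) candidates
    \<longrightarrow> x \<in> set (quads @ [[A3,A4,A2,A3], [A4,A2,A3,A4], [A0,A1,A0,A1], [A1,A0,A1,A0]])) candidates"
  by code_simp

text \<open>Of the surplus candidates, four lack a neighbour and \<open>0101\<close>,
  \<open>1010\<close> are squares. The words \<open>3423\<close> and \<open>4234\<close> force the
  contexts \<open>23423b\<close> and \<open>042342\<close>, which the last two assumptions
  exclude.\<close>

lemma b5_like_if_candidates:
  assumes L: "language L"
    and squarefree: "\<And>u. u \<noteq> [] \<Longrightarrow> u @ u \<notin> L"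
    and cand: "\<And>x. x \<in> L \<Longrightarrow> length x = 4 \<Longrightarrow> x \<in> set candidates"
    and no1: "\<And>b. [A2,A3,A4,A2,A3,b] \<notin> L"
    and no2: "[A0,A4,A2,A3,A4,A2] \<notin> L"
  shows "b5_like L"
proof -
  have main: "x \<in> set quads \<or> x = [A3,A4,A2,A3] \<or> x = [A4,A2,A3,A4]"
    if x: "x \<in> L" "length x = 4" for x
  proof -
    obtain a b where ab: "a # x @ [b] \<in> L" using L x by (auto simp: language_def)
    obtain c d e f where x': "x = [c, d, e, f]" using x(2) unfolding length_4 by blast
    have "[a, c, d, e] \<in> L" "[d, e, f, b] \<in> L"
      using ab language_append[OF L, of "[]" "[a, c, d, e]" "[f, b]"]
        language_append[OF L, of "[a, c]" "[d, e, f, b]" "[]"] x' by auto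
    then have "[a, c, d, e] \<in> set candidates" "[d, e, f, b] \<in> set candidates" "x \<in> set candidates"
      using cand x by auto
    moreover have "butlast x = tl [a, c, d, e]" "tl x = butlast [d, e, f, b]" using x' by simp_all
    ultimately have "x \<in> set (quads @ [[A3,A4,A2,A3], [A4,A2,A3,A4], [A0,A1,A0,A1], [A1,A0,A1,A0]])"
      using candidates_extendable unfolding list_all_iff list_ex_iff by blast
    moreover have "[A0,A1,A0,A1] \<notin> L" "[A1,A0,A1,A0] \<notin> L"
      using squarefree[of "[A0,A1]"] squarefree[of "[A1,A0]"] by auto
    ultimately show ?thesis using x by auto
  qed
  have no3: "[A3,A4,A2,A3] \<notin> L"
  proof
    assume "[A3,A4,A2,A3] \<in> L"
    then obtain a b where ab: "[a,A3,A4,A2,A3,b] \<in> L" using L by (force simp: language_def)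
    then have "[a,A3,A4,A2] \<in> L"
      using language_append[OF L, of "[]" "[a,A3,A4,A2]"] by auto
    then have "a = A2" using main[of "[a,A3,A4,A2]"] by (auto simp: quads_def)
    then show False using ab no1 by blast
  qed
  have "[A4,A2,A3,A4] \<notin> L"
  proof
    assume "[A4,A2,A3,A4] \<in> L"
    then obtain a b where ab: "[a,A4,A2,A3,A4,b] \<in> L" using L by (force simp: language_def)
    then have "[a,A4,A2,A3] \<in> L" "[A2,A3,A4,b] \<in> L"
      using language_append[OF L, of "[]" "[a,A4,A2,A3]"]
        language_append[OF L, of "[a,A4]" "[A2,A3,A4,b]" "[]"] by auto
    then have "a = A0" "b = A2" using main[of "[a,A4,A2,A3]"] main[of "[A2,A3,A4,b]"] no3 by (auto simp: quads_def)
    then show False using ab no2 by blast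
  qed
  then show ?thesis using L squarefree main no3 unfolding b5_like_def by blast
qed

section \<open>Desubstitution by \<open>f5\<close>\<close>

definition cuts5 :: "letter list set" where
  "cuts5 = {[A0], [A2], [A4]}"

text \<open>In the images under \<open>f5\<close> the letters \<open>0\<close>, \<open>2\<close>,
  \<open>4\<close> occur only in first position and \<open>1\<close>, \<open>3\<close> only in
  second, so the former mark where images start. Windows of length 4 show enough context to
  parse.\<close>

lemma quads_parse:
  "list_all (\<lambda>x. last x \<in> {A0, A2, A4} \<longrightarrow> list_ex (\<lambda>a. suffix (f5 a) (butlast x)) [A0,A1,A2,A3,A4]) quads"
  "list_all (\<lambda>x. hd x \<in> {A0, A2, A4} \<longrightarrow>
    list_ex (\<lambda>a. list_ex (\<lambda>c. prefix (f5 a @ [c]) x) [A0,A2,A4]) [A0,A1,A2,A3,A4]) quads"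
  "list_all (\<lambda>x. list_ex (\<lambda>d. d \<in> {A0, A2, A4}) (tl x)) quads"
  by code_simp+

lemma desubstitution_f5:
  assumes "b5_like L"
  shows "desubstitution L f5 cuts5 3"
proof -
  have L: "language L" and quads: "\<And>x. x \<in> L \<Longrightarrow> length x = 4 \<Longrightarrow> x \<in> set quads"
    using assms by (auto simp: b5_like_def)
  show ?thesis
  proof
    show "\<exists>m\<in>cuts5. prefix m (f5 a)" for a by (cases a) (auto simp: cuts5_def)
    show "[] \<notin> cuts5" by (simp add: cuts5_def)
  next
    fix u m assume um: "u @ m \<in> L" "m \<in> cuts5" "3 \<le> length u"
    obtain c where c: "m = [c]" "c \<in> {A0, A2, A4}" using um by (auto simp: cuts5_def)
    define u1 u2 where "u1 = take (length u - 3) u" and "u2 = drop (length u - 3) u"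
    have u: "u = u1 @ u2" "length u2 = 3" using um by (auto simp: u1_def u2_def)
    then have "u2 @ [c] \<in> L" using um c language_append[OF L, of u1 "u2 @ [c]" "[]"] by simp
    then have "u2 @ [c] \<in> set quads" using quads u by auto
    then have "list_ex (\<lambda>a. suffix (f5 a) (butlast (u2 @ [c]))) [A0,A1,A2,A3,A4]"
      using quads_parse(1) c(2) unfolding list_all_iff by (metis last_snoc)
    then have "\<exists>a. suffix (f5 a) u2" unfolding list_ex_iff butlast_snoc by blast
    then show "\<exists>a. suffix (f5 a) u" using u suffix_append by blast
  next
    fix u m assume um: "m @ u \<in> L" "m \<in> cuts5" "3 \<le> length u"
    obtain c where c: "m = [c]" "c \<in> {A0, A2, A4}" using um by (auto simp: cuts5_def)
    have "c # take 3 u \<in> L"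
      using um c language_append[OF L, of "[]" "c # take 3 u" "drop 3 u"] by simp
    then have "c # take 3 u \<in> set quads" using quads um by auto
    then have "list_ex (\<lambda>a. list_ex (\<lambda>d. prefix (f5 a @ [d]) (c # take 3 u)) [A0,A2,A4]) [A0,A1,A2,A3,A4]"
      using quads_parse(2) c(2) unfolding list_all_iff by (metis list.sel(1))
    then obtain a d where "prefix (f5 a @ [d]) (c # take 3 u)" "[d] \<in> cuts5"
      unfolding list_ex_iff cuts5_def set_simps by blast
    moreover have "prefix (c # take 3 u) (m @ u)" using c by (simp add: take_is_prefix)
    ultimately show "\<exists>a. \<exists>m'\<in>cuts5. prefix (f5 a @ m') (m @ u)"
      using prefix_order.trans by blast
  next
    fix u assume u: "u \<in> L" "3 \<le> length u"
    obtain v where v: "v @ u \<in> L" "length v = 1" using language_extend_left[OF L u(1)] by metis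
    obtain c where "v = [c]" using v by (auto simp: length_Suc_conv)
    then have "c # take 3 u \<in> L"
      using v language_append[OF L, of "[]" "c # take 3 u" "drop 3 u"] by simp
    then have "c # take 3 u \<in> set quads" using quads u by auto
    then have "list_ex (\<lambda>d. d \<in> {A0, A2, A4}) (take 3 u)"
      using quads_parse(3) unfolding list_all_iff by (metis list.sel(3))
    then obtain d where "d \<in> set u" "[d] \<in> cuts5"
      using in_set_takeD unfolding list_ex_iff cuts5_def by fast
    then show "\<exists>m\<in>cuts5. sublist m u"
      by (metis append_Cons append_Nil split_list sublist_appendI)
  qed (rule L)
qed

abbreviation preimage5 :: "letter list set \<Rightarrow> letter list set" where
  "preimage5 \<equiv> preimage f5 cuts5"

fun windows_ok :: "letter list \<Rightarrow> bool" where
  "windows_ok (a # b # c # d # x) = ([a, b, c, d] \<in> set quads \<and> windows_ok (b # c # d # x))"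
| "windows_ok x = True"

lemma windows_ok_if_quads:
  assumes "language L" "\<And>x. x \<in> L \<Longrightarrow> length x = 4 \<Longrightarrow> x \<in> set quads" "x \<in> L"
  shows "windows_ok x"
  using assms(3)
proof (induction x rule: windows_ok.induct)
  case (1 a b c d x)
  then show ?case
    using assms(2)[of "[a, b, c, d]"] language_append[OF assms(1), of "[]" "[a, b, c, d]" x]
      language_append[OF assms(1), of "[a]" "b # c # d # x" "[]"] by auto
qed auto

text \<open>A finite superset of the words of length \<open>n\<close> in the preimage, grown to the
  left and pruned by the windows of their images.\<close>

fun parents :: "nat \<Rightarrow> letter list list" where
  "parents 0 = [[]]"
| "parents (Suc n) = filter (\<lambda>y. list_ex (\<lambda>c. windows_ok (morph f5 y @ [c])) [A0, A2, A4])
    (concat (map (\<lambda>y. map (\<lambda>a. a # y) [A0, A1, A2, A3, A4]) (parents n)))"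

lemma parents_4: "list_all (\<lambda>y. y \<in> set candidates) (parents 4)"
  by code_simp

lemma in_parents:
  assumes "b5_like L" "y \<in> preimage5 L"
  shows "y \<in> set (parents (length y))"
proof -
  interpret desubstitution L f5 cuts5 3 using assms desubstitution_f5 by blast
  have quads: "\<And>x. x \<in> L \<Longrightarrow> length x = 4 \<Longrightarrow> x \<in> set quads"
    using assms(1) by (auto simp: b5_like_def)
  show ?thesis using assms(2)
  proof (induction y)
    case (Cons a y)
    then have "y \<in> preimage5 L" using preimage_append[of "[a]" y "[]"] by simp
    obtain c where "c \<in> {A0, A2, A4}" "morph f5 (a # y) @ [c] \<in> L"
      using Cons.prems by (auto simp: preimage_def cuts5_def)
    then have "list_ex (\<lambda>c. windows_ok (morph f5 (a # y) @ [c])) [A0, A2, A4]"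
      using windows_ok_if_quads[OF language quads] by (auto simp del: morph_simps)
    moreover have "a \<in> set [A0, A1, A2, A3, A4]" by (cases a) auto
    ultimately show ?case using Cons.IH[OF \<open>y \<in> preimage5 L\<close>] by (auto simp del: morph_simps)
  qed simp
qed

lemma b5_like_preimage5:
  assumes "b5_like L"
  shows "b5_like (preimage5 L)"
proof -
  interpret desubstitution L f5 cuts5 3 using assms desubstitution_f5 by blast
  have quads: "\<And>x. x \<in> L \<Longrightarrow> length x = 4 \<Longrightarrow> x \<in> set quads"
    and squarefree: "\<And>u. u \<noteq> [] \<Longrightarrow> u @ u \<notin> L"
    using assms by (auto simp: b5_like_def)
  show ?thesis
  proof (rule b5_like_if_candidates[OF language_preimage])
    show "u @ u \<notin> preimage5 L" if "u \<noteq> []" for u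
      using square_preimage[OF _ that] squarefree by blast
    show "y \<in> set candidates" if "y \<in> preimage5 L" "length y = 4" for y
      using in_parents[OF assms that(1)] parents_4 that(2) by (auto simp: list_all_iff)
    show "[A2,A3,A4,A2,A3,b] \<notin> preimage5 L" for b
    proof
      assume "[A2,A3,A4,A2,A3,b] \<in> preimage5 L"
      then obtain c x where x: "[A4,A2,A1,A0,A4,A2,A1] @ x \<in> L" "x = f5 b @ [c]"
        by (auto simp: preimage_def cuts5_def)
      then obtain d x' where x': "x = d # x'" by (cases b) auto
      then have "[A4,A2,A1,d] \<in> L" "[A4,A2,A1,A0,A4,A2,A1,d] \<in> L"
        using x language_append[OF language, of "[A4,A2,A1,A0]" "[A4,A2,A1,d]" x']
          language_append[OF language, of "[]" "[A4,A2,A1,A0,A4,A2,A1,d]" x'] by auto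
      \<comment> \<open>Only \<open>4210\<close> in \<open>quads\<close> starts with
        \<open>421\<close>; it completes the square of \<open>4210\<close>.\<close>
      moreover from this have "d = A0" using quads[of "[A4,A2,A1,d]"] by (auto simp: quads_def)
      ultimately show False using squarefree[of "[A4,A2,A1,A0]"] by simp
    qed
    show "[A0,A4,A2,A3,A4,A2] \<notin> preimage5 L"
    proof
      assume "[A0,A4,A2,A3,A4,A2] \<in> preimage5 L"
      then obtain c where c: "[A0,A1,A0,A4,A2,A1,A0,A4,c] \<in> L"
        by (auto simp: preimage_def cuts5_def)
      then have "[A1,A0,A4,c] \<in> L" "[A1,A0,A4,A2,A1,A0,A4,c] \<in> L"
        using language_append[OF language, of "[A0,A1,A0,A4,A2]" "[A1,A0,A4,c]" "[]"]
          language_append[OF language, of "[A0]" "[A1,A0,A4,A2,A1,A0,A4,c]" "[]"] by auto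
      \<comment> \<open>Only \<open>1042\<close> in \<open>quads\<close> starts with
        \<open>104\<close>.\<close>
      moreover from this have "c = A2" using quads[of "[A1,A0,A4,c]"] by (auto simp: quads_def)
      ultimately show False using squarefree[of "[A1,A0,A4,A2]"] by simp
    qed
  qed
qed

section \<open>Descent to the factors of \<open>b5\<close>\<close>

lemma sublist_morph: "sublist u v \<Longrightarrow> sublist (morph g u) (morph g v)"
  unfolding sublist_def by (metis morph_simps(3))

text \<open>Three steps are taken at once because \<open>2\<close> needs three applications of
  \<open>f5\<close> to grow: it becomes \<open>4\<close>, \<open>0\<close>,
  \<open>01\<close>.\<close>

lemma preimage5_cover3:
  assumes "b5_like L" "y \<in> L"
  obtains L' z where "b5_like L'" "z \<in> L'" "sublist y (morph f5 (morph f5 (morph f5 z)))"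
    "\<And>v. v \<in> L' \<Longrightarrow> morph f5 (morph f5 (morph f5 v)) \<in> L"
proof -
  have one: "\<exists>z\<in>preimage5 K. sublist x (morph f5 z)" if "b5_like K" "x \<in> K" for K x
  proof -
    interpret desubstitution K f5 cuts5 3 using that desubstitution_f5 by blast
    show ?thesis using cover[OF that(2)] by blast
  qed
  have image: "morph f5 z \<in> K" if "b5_like K" "z \<in> preimage5 K" for K z
  proof -
    interpret desubstitution K f5 cuts5 3 using that desubstitution_f5 by blast
    show ?thesis using morph_preimage[OF that(2)] .
  qed
  let ?L1 = "preimage5 L" let ?L2 = "preimage5 ?L1" let ?L3 = "preimage5 ?L2"
  have L: "b5_like ?L1" "b5_like ?L2" "b5_like ?L3" using assms b5_like_preimage5 by blast+
  obtain z1 where z1: "z1 \<in> ?L1" "sublist y (morph f5 z1)" using one assms by blast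
  obtain z2 where z2: "z2 \<in> ?L2" "sublist z1 (morph f5 z2)" using one L z1 by blast
  obtain z3 where z3: "z3 \<in> ?L3" "sublist z2 (morph f5 z3)" using one L z2 by blast
  have "sublist y (morph f5 (morph f5 (morph f5 z3)))"
    using z1 z2 z3 sublist_morph sublist_order.order.trans by meson
  then show ?thesis using that[of ?L3 z3] L z3 image assms by blast
qed

lemma morph_decompose_Cons:
  assumes "prefix y (morph g z)" "y \<noteq> []"
  obtains z' where "prefix z' z" "prefix y (morph g z')" "z' \<noteq> []" "length (morph g (butlast z')) < length y"
proof -
  have "\<exists>z'. prefix z' z \<and> prefix y (morph g z') \<and> z' \<noteq> [] \<and> length (morph g (butlast z')) < length y"
    using assms(1)
  proof (induction z rule: rev_induct)
    case Nil
    then show ?case using assms(2) by simp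
  next
    case (snoc a z)
    show ?case
    proof (cases "length (morph g z) < length y")
      case True
      then show ?thesis using snoc.prems by (intro exI[of _ "z @ [a]"]) auto
    next
      case False
      then have "prefix y (morph g z)"
        using snoc.prems prefix_length_prefix[of y "morph g (z @ [a])" "morph g z"] by simp
      then show ?thesis using snoc.IH by (meson prefix_append prefix_order.trans)
    qed
  qed
  then show ?thesis using that by blast
qed

lemma length_morph_ge2:
  assumes "\<And>a. 2 \<le> length (g a)"
  shows "2 * length z \<le> length (morph g z)"
proof (induction z)
  case (Cons a z)
  then show ?case using assms[of a] by simp
qed simp

text \<open>An occurrence of \<open>y\<close> starts inside the image of one letter, and the images
  of the further letters, except the last, lie inside \<open>y\<close>. Hence at most
  \<open>1 + length y / 2\<close> letters are needed, fewer than \<open>length y\<close> from length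
  3 on.\<close>

lemma sublist_morph_shrink:
  assumes "sublist y (morph g z)" "3 \<le> length y" "\<And>a. 2 \<le> length (g a)"
  obtains z' where "sublist z' z" "sublist y (morph g z')" "length z' < length y"
proof -
  have "\<exists>z'. sublist z' z \<and> sublist y (morph g z') \<and> length z' < length y"
    using assms(1)
  proof (induction z)
    case Nil
    then show ?case using assms(2) by simp
  next
    case (Cons a z)
    then obtain u v where uv: "g a @ morph g z = u @ y @ v" by (auto simp: sublist_def)
    show ?case
    proof (cases "length (g a) \<le> length u")
      case True
      then obtain u' where "u = g a @ u'" using uv by (auto simp: append_eq_append_conv_if)
        (metis append_take_drop_id)
      then have "sublist y (morph g z)" using uv by auto
      then show ?thesis using Cons.IH by (meson sublist_Cons_right)
    next
      case False
      then obtain s where s: "g a = u @ s" "s \<noteq> []"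
        using uv by (auto simp: append_eq_append_conv2)
      have sy: "s @ morph g z = y @ v" using uv s by simp
      show ?thesis
      proof (cases "length y \<le> length s")
        case True
        then have "prefix y s" using sy by (metis prefix_def prefix_length_prefix)
        then have "sublist y (morph g [a])" using s by (auto simp: prefix_def sublist_def)
        then show ?thesis using assms(2) by (intro exI[of _ "[a]"]) auto
      next
        case len: False
        then obtain y' where y': "y = s @ y'" "y' \<noteq> []" using sy by (auto simp: append_eq_append_conv2)
        then have "prefix y' (morph g z)" using sy by (auto simp: prefix_def)
        then obtain z' where z': "prefix z' z" "prefix y' (morph g z')" "z' \<noteq> []"
          "length (morph g (butlast z')) < length y'"
          using morph_decompose_Cons y'(2) by blast
        have "2 * (length z' - 1) < length y'"
          using z'(4) length_morph_ge2[of g "butlast z'", OF assms(3)] by simp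
        moreover have "length s \<ge> 1" using s by (cases s) auto
        ultimately have "length (a # z') < length y" using y' assms(2) z'(3) by (cases z') auto
        moreover have "sublist (a # z') (a # z)" using z'(1) by (simp add: prefix_imp_sublist)
        moreover have "sublist y (morph g (a # z'))"
          using z'(2) s y' by (auto simp: prefix_def sublist_def)
        ultimately show ?thesis by blast
      qed
    qed
  qed
  then show ?thesis using that by blast
qed

lemma quads_in_f5_iter: "list_all (\<lambda>x. sublist x (f5_iter 7)) quads"
  by code_simp

text \<open>Descent on the length, over all languages at once because the shorter word lies in an
  iterated preimage. Words of length at most 2 are extended to length 4 and found among
  \<open>quads\<close>.\<close>

lemma factor_f5_iter:
  assumes "b5_like L" "y \<in> L"
  shows "\<exists>n. sublist y (f5_iter n)"
  using assms
proof (induction "length y" arbitrary: y L rule: less_induct)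
  case less
  show ?case
  proof (cases "3 \<le> length y")
    case False
    have L: "language L" using less.prems by (simp add: b5_like_def)
    obtain u where u: "length u = 4 - length y" "y @ u \<in> L"
      using language_extend_right[OF L less.prems(2)] by blast
    then have "y @ u \<in> set quads" using less.prems False by (auto simp: b5_like_def)
    then have "sublist (y @ u) (f5_iter 7)" using quads_in_f5_iter by (auto simp: list_all_iff)
    then have "sublist y (f5_iter 7)"
      by (meson sublist_append_rightI sublist_order.order.trans)
    then show ?thesis by blast
  next
    case True
    \<comment> \<open>the cube of \<^const>\<open>f5\<close> at least doubles the length of a word\<close>
    define g where "g a = morph f5 (morph f5 (f5 a))" for a
    have g: "morph f5 (morph f5 (morph f5 x)) = morph g x" for x
      by (induction x) (simp_all add: g_def)
    obtain L' z where z: "b5_like L'" "z \<in> L'" "sublist y (morph g z)"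
      using preimage5_cover3[OF less.prems] unfolding g by blast
    have "2 \<le> length (g a)" for a by (cases a) (simp_all add: g_def)
    then obtain z' where z': "sublist z' z" "sublist y (morph g z')" "length z' < length y"
      using sublist_morph_shrink[OF z(3) True] by blast
    have "z' \<in> L'" using z z' language_sublist by (auto simp: b5_like_def)
    then obtain n where "sublist z' (f5_iter n)" using less.hyps z z' by blast
    then have "sublist (morph g z') (morph g (f5_iter n))" by (rule sublist_morph)
    then have "sublist y (f5_iter (Suc (Suc (Suc n))))"
      using z'(2) g[of "f5_iter n"] sublist_order.order.trans by fastforce
    then show ?thesis by blast
  qed
qed

text \<open>Three applications of \<open>f5\<close> turn any letter into a word that contains
  \<open>0\<close>, and the threefold preimage contains some letter.\<close>

lemma A0_in_b5_like:
  assumes "b5_like L"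
  shows "[A0] \<in> L"
proof -
  have L: "language L" "[] \<in> L" using assms by (auto simp: b5_like_def language_def)
  obtain L' z where z: "b5_like L'" "\<And>v. v \<in> L' \<Longrightarrow> morph f5 (morph f5 (morph f5 v)) \<in> L"
    using preimage5_cover3[OF assms L(2)] by blast
  obtain a where "[a] \<in> L'" using z(1) language_Cons[of L' "[]"] by (auto simp: b5_like_def language_def)
  then have "morph f5 (morph f5 (f5 a)) \<in> L" using z(2)[of "[a]"] by simp
  moreover have "sublist [A0] (morph f5 (morph f5 (f5 a)))"
    by (cases a) (simp_all add: sublist_code)
  ultimately show ?thesis using language_sublist[OF L(1)] by blast
qed

text \<open>By induction for all \<open>L\<close>, the previous iterate lies in
  \<open>preimage5 L\<close>, so its image lies in \<open>L\<close>.\<close>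

lemma f5_iter_in_b5_like: "b5_like L \<Longrightarrow> f5_iter n \<in> L"
proof (induction n arbitrary: L)
  case (Suc n)
  interpret desubstitution L f5 cuts5 3 using Suc.prems desubstitution_f5 by blast
  show ?case using morph_preimage Suc.IH[OF b5_like_preimage5[OF Suc.prems]] by simp
qed (simp add: A0_in_b5_like)

section \<open>Desubstitution of the binary word\<close>

fun keep :: "bit list \<Rightarrow> roots option \<times> roots option \<Rightarrow> bit list list \<Rightarrow> bit list list" where
  "keep x (None, None) ws = ws"
| "keep x (Some _, None) ws = (B0 # x) # ws"
| "keep x (None, Some _) ws = (B1 # x) # ws"
| "keep x (Some _, Some _) ws = (B0 # x) # (B1 # x) # ws"

text \<open>All twelve roots are present from the start, so an extension is dropped when the scan
  meets any other square or a forbidden overlap.\<close>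

fun extend :: "bit list list \<Rightarrow> bit list list" where
  "extend [] = []"
| "extend (x # xs) = keep x (scan full_plan [] x x (Some roots12) (Some roots12)) (extend xs)"

fun words :: "nat \<Rightarrow> bit list list" where
  "words 0 = [[]]"
| "words (Suc n) = extend (words n)"

text \<open>Letters are added from right to left, so the first argument is the reversal of a
  block.\<close>

fun prepend :: "bit list \<Rightarrow> bit list \<Rightarrow> bit list option"
  and prepend_if :: "bit \<Rightarrow> bit list \<Rightarrow> bit list \<Rightarrow> roots option \<times> roots option \<Rightarrow> bit list option" where
  "prepend [] x = Some x"
| "prepend (b # bs) x = prepend_if b bs x (scan full_plan [] x x (Some roots12) (Some roots12))"
| "prepend_if B0 bs x (None, R) = None"
| "prepend_if B0 bs x (Some K, R) = prepend bs (B0 # x)"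
| "prepend_if B1 bs x (R, None) = None"
| "prepend_if B1 bs x (R, Some K) = prepend bs (B1 # x)"

text \<open>\<open>h12\<close> erases \<open>4\<close>, which blocks parsing; after three
  applications of \<open>f5\<close> every image is nonempty and starts with
  \<open>0011\<close>.\<close>

definition h3 :: "letter \<Rightarrow> bit list" where
  "h3 a = morph h12 (morph f5 (morph f5 (f5 a)))"

lemma rev_h3:
  "rev (h3 A0) = [B1,B0,B1,B0,B0,B1,B1,B0,B1,B0,B0,B1,B0,B1,B1,B0,B0]"
  "rev (h3 A1) = [B1,B1,B0,B1,B0,B0,B1,B1,B0,B0]"
  "rev (h3 A2) = [B1,B0,B1,B1,B0,B0]"
  "rev (h3 A3) = [B1,B0,B1,B0,B0,B1,B1,B0,B0]"
  "rev (h3 A4) = [B1,B1,B0,B1,B0,B0,B1,B0,B1,B1,B0,B0]"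
  by (simp_all add: h3_def)

fun explore :: "nat \<Rightarrow> letter list \<Rightarrow> bit list option \<Rightarrow> letter list list" where
  "explore n y None = []"
| "explore 0 y (Some x) = [y]"
| "explore (Suc n) y (Some x) =
    explore n (A0 # y) (prepend (rev (h3 A0)) x) @ explore n (A1 # y) (prepend (rev (h3 A1)) x) @
    explore n (A2 # y) (prepend (rev (h3 A2)) x) @ explore n (A3 # y) (prepend (rev (h3 A3)) x) @
    explore n (A4 # y) (prepend (rev (h3 A4)) x)"

lemma explore_4:
  "list_all (\<lambda>y. y \<in> set candidates)
    (explore (Suc (Suc (Suc (Suc 0)))) [] (Some [B0, B0, B1, B1]))"
  by (simp only: evaluation_rules rev_h3 explore.simps prepend.simps prepend_if.simps
      append_Nil append_Cons) code_simp

definition parses :: "bit list \<Rightarrow> bool" where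
  "parses x \<longleftrightarrow>
    (suffix [B0,B0,B1,B1] x \<longrightarrow> list_ex (\<lambda>a. suffix (h3 a @ [B0,B0,B1,B1]) x) [A0,A1,A2,A3,A4]) \<and>
    (prefix [B0,B0,B1,B1] x \<longrightarrow> list_ex (\<lambda>a. prefix (h3 a @ [B0,B0,B1,B1]) x) [A0,A1,A2,A3,A4]) \<and>
    sublist [B0,B0,B1,B1] x"

text \<open>The length 21 has room for the longest image, that of \<open>0\<close> with 17 letters,
  and the marker \<open>0011\<close> after it.\<close>

lemma parses_words_21: "list_all parses (words 21)"
  by (simp only: evaluation_rules words.simps extend.simps keep.simps unary) code_simp

section \<open>The preimage under \<open>h3\<close>\<close>

locale twelve_squares = few_squares +
  assumes overlap_01010: "[B0, B1, B0, B1, B0] \<in> L"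
begin

text \<open>For the empty target list \<open>None\<close> is never sound, so an extension in
  \<open>L\<close> cannot be closed.\<close>

lemma scan_roots12:
  assumes "scan full_plan [] x x (Some roots12) (Some roots12) = (R0, R1)"
  shows "B0 # x \<in> L \<Longrightarrow> R0 \<noteq> None" "B1 # x \<in> L \<Longrightarrow> R1 \<noteq> None"
proof -
  have "sound [] (Some roots12)"
    using roots_eq[OF overlap_01010] by (simp add: roots12_def)
  then have "(B0 # x \<in> L \<longrightarrow> sound [] R0) \<and> (B1 # x \<in> L \<longrightarrow> sound [] R1)"
    using sound_scan[OF plan_ok_full_plan, of x x "[]" "Some roots12" "Some roots12"] assms by simp
  then show "B0 # x \<in> L \<Longrightarrow> R0 \<noteq> None" "B1 # x \<in> L \<Longrightarrow> R1 \<noteq> None"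
    by (cases R0; cases R1; auto)+
qed

lemma in_extend:
  assumes "a # x \<in> L" "x \<in> set xs"
  shows "a # x \<in> set (extend xs)"
  using assms(2)
proof (induction xs)
  case (Cons y ys)
  obtain R0 R1 where R: "scan full_plan [] y y (Some roots12) (Some roots12) = (R0, R1)" by fastforce
  have "set (extend ys) \<subseteq> set (keep y (R0, R1) (extend ys))"
    by (cases R0; cases R1) auto
  moreover have "a # x \<in> set (keep y (R0, R1) (extend ys))" if "x = y"
    using scan_roots12[OF R] assms(1) that by (cases a; cases R0; cases R1) auto
  ultimately show ?case using Cons R by auto
qed simp

lemma in_words: "x \<in> L \<Longrightarrow> x \<in> set (words (length x))"
proof (induction x)
  case (Cons a x)
  then have "x \<in> L" using language_append[OF language, of "[a]" x "[]"] by simp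
  then show ?case using Cons in_extend by simp
qed simp

lemma parses_21:
  assumes "x \<in> L" "length x = 21"
  shows "parses x"
  using in_words[OF assms(1)] parses_words_21 assms(2) by (simp add: list_all_iff)

lemma prepend_eq:
  assumes "rev bs @ x \<in> L"
  shows "prepend bs x = Some (rev bs @ x)"
  using assms
proof (induction bs arbitrary: x)
  case (Cons b bs)
  obtain R0 R1 where R: "scan full_plan [] x x (Some roots12) (Some roots12) = (R0, R1)" by fastforce
  have "b # x \<in> L" using Cons.prems language_append[OF language, of "rev bs" "b # x" "[]"] by simp
  then show ?case using scan_roots12[OF R] Cons R by (cases b; cases R0; cases R1) auto
qed simp

lemma in_explore:
  assumes "morph h3 z @ x \<in> L"
  shows "z @ y \<in> set (explore (length z) y (Some x))"
  using assms
proof (induction z arbitrary: x y rule: rev_induct)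
  case (snoc a z)
  have "h3 a @ x \<in> L"
    using snoc.prems language_append[OF language, of "morph h3 z" "h3 a @ x" "[]"] by simp
  then have "prepend (rev (h3 a)) x = Some (h3 a @ x)"
    using prepend_eq[of "rev (h3 a)" x] by simp
  moreover have "z @ a # y \<in> set (explore (length z) (a # y) (Some (h3 a @ x)))"
    using snoc.IH[of "h3 a @ x" "a # y"] snoc.prems by simp
  ultimately show ?case by (cases a) auto
qed simp

lemma desubstitution_h3: "desubstitution L h3 {[B0, B0, B1, B1]} 21"
proof
  show "\<exists>m\<in>{[B0, B0, B1, B1]}. prefix m (h3 a)" for a by (cases a) (simp_all add: h3_def)
next
  fix u m assume um: "u @ m \<in> L" "m \<in> {[B0, B0, B1, B1]}" "21 \<le> length u"
  \<comment> \<open>17 letters and the marker make up the checked length 21.\<close>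
  define u1 u2 where "u1 = take (length u - 17) u" and "u2 = drop (length u - 17) u"
  have u: "u = u1 @ u2" "length u2 = 17" using um by (auto simp: u1_def u2_def)
  then have "parses (u2 @ m)"
    using um language_append[OF language, of u1 "u2 @ m" "[]"] by (intro parses_21) auto
  moreover have "suffix [B0, B0, B1, B1] (u2 @ m)" using um by (auto intro: suffixI)
  ultimately have "\<exists>a. suffix (h3 a @ [B0, B0, B1, B1]) (u2 @ m)"
    unfolding parses_def list_ex_iff by blast
  then have "\<exists>a. suffix (h3 a) u2"
    using um by auto
  then show "\<exists>a. suffix (h3 a) u" using u suffix_append by blast
next
  fix u m assume um: "m @ u \<in> L" "m \<in> {[B0, B0, B1, B1]}" "21 \<le> length u"
  have "parses (m @ take 17 u)"
    using um language_append[OF language, of "[]" "m @ take 17 u" "drop 17 u"] by (intro parses_21) auto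
  moreover have "prefix [B0, B0, B1, B1] (m @ take 17 u)" using um by simp
  ultimately have "\<exists>a. prefix (h3 a @ [B0, B0, B1, B1]) (m @ take 17 u)"
    unfolding parses_def list_ex_iff by blast
  moreover have "prefix (m @ take 17 u) (m @ u)" by (simp add: take_is_prefix)
  ultimately show "\<exists>a. \<exists>m'\<in>{[B0, B0, B1, B1]}. prefix (h3 a @ m') (m @ u)"
    using prefix_order.trans by blast
next
  fix u assume u: "u \<in> L" "21 \<le> length u"
  have "parses (take 21 u)"
    using u language_append[OF language, of "[]" "take 21 u" "drop 21 u"] by (intro parses_21) auto
  then have "sublist [B0, B0, B1, B1] (take 21 u)" by (simp add: parses_def)
  then show "\<exists>m\<in>{[B0, B0, B1, B1]}. sublist m u"
    using sublist_take sublist_order.order.trans by blast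
qed (auto simp: language)

text \<open>Images under \<open>h3\<close> start with \<open>00\<close>, so this makes the preimage
  square-free.\<close>

lemma no_square_if_00:
  assumes "r = B0 # B0 # x"
  shows "r @ r \<notin> L"
proof
  assume "r @ r \<in> L"
  then have "r \<in> roots" using assms by (simp add: roots_def)
  then have "r \<in> set roots12" unfolding roots_eq[OF overlap_01010] .
  then show False using assms by (simp add: roots12_def)
qed

lemma b5_like_preimage: "b5_like (preimage h3 {[B0, B0, B1, B1]} L)" (is "b5_like ?D")
proof -
  interpret desubstitution L h3 "{[B0, B0, B1, B1]}" 21 by (rule desubstitution_h3)
  have cand: "y \<in> set candidates" if "y \<in> ?D" "length y = 4" for y
  proof -
    have "morph h3 y @ [B0, B0, B1, B1] \<in> L" using that by (simp add: preimage_def)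
    then have "y @ [] \<in> set (explore (length y) [] (Some [B0, B0, B1, B1]))"
      by (rule in_explore)
    then show ?thesis using explore_4 that by (simp add: list_all_iff numeral_eq_Suc)
  qed
  show ?thesis
  proof (rule b5_like_if_candidates[OF language_preimage _ cand])
    show "u @ u \<notin> ?D" if u: "u \<noteq> []" for u
    proof
      assume "u @ u \<in> ?D"
      then have "morph h3 u @ morph h3 u \<in> L" using square_preimage u by blast
      moreover obtain a v where "u = a # v" using u by (cases u) auto
      then have "\<exists>x. morph h3 u = B0 # B0 # x" by (cases a) (auto simp: h3_def)
      ultimately show False using no_square_if_00 by blast
    qed
    show "[A2,A3,A4,A2,A3,b] \<notin> ?D" for b
    proof
      assume D: "[A2,A3,A4,A2,A3,b] \<in> ?D"
      then have "[A4,A2,A3,b] \<in> ?D" using preimage_append[of "[A2,A3]" "[A4,A2,A3,b]" "[]"] by simp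
      then have "b = A0 \<or> b = A4" using cand[of "[A4,A2,A3,b]"] by (auto simp: candidates_def quads_def)
      \<comment> \<open>\<open>f5\<close> maps \<open>23423\<close> to \<open>4210421\<close>, and
        for \<open>b\<close> equal to \<open>0\<close> or \<open>4\<close> the next letter is
        \<open>0\<close>, which completes the square of \<open>4210\<close>.\<close>
      let ?r = "morph h12 (morph f5 (morph f5 [A4,A2,A1,A0]))"
      obtain s where "morph h3 [A2,A3,A4,A2,A3,b] = (?r @ ?r) @ s"
        using \<open>b = A0 \<or> b = A4\<close> by (auto simp: h3_def)
      then have "?r @ ?r \<in> L"
        using morph_preimage[OF D] language_append[OF language, of "[]" "?r @ ?r" s] by simp
      moreover have "\<exists>x. ?r = B0 # B0 # x" by simp
      ultimately show False using no_square_if_00 by blast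
    qed
    show "[A0,A4,A2,A3,A4,A2] \<notin> ?D"
    proof
      assume "[A0,A4,A2,A3,A4,A2] \<in> ?D"
      then have "morph h3 [A0,A4,A2,A3,A4,A2] @ [B0, B0, B1, B1] \<in> L"
        by (auto simp: preimage_def)
      \<comment> \<open>\<open>f5\<close> maps \<open>042342\<close> to \<open>01042104\<close>,
        whose last seven letters lack a \<open>2\<close> to be the square of \<open>1042\<close>.
        The marker \<open>0011\<close> is what the remaining maps make of that
        \<open>2\<close>.\<close>
      moreover let ?r = "morph h12 (morph f5 (morph f5 [A1,A0,A4,A2]))"
      have "morph h3 [A0,A4,A2,A3,A4,A2] @ [B0, B0, B1, B1] =
          morph h12 (morph f5 (morph f5 [A0])) @ (?r @ ?r) @ []"
        by (simp add: h3_def)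
      ultimately have "?r @ ?r \<in> L"
        using language_append[OF language, of _ "?r @ ?r"] by metis
      moreover have "\<exists>x. ?r = B0 # B0 # x" by simp
      ultimately show False using no_square_if_00 by blast
    qed
  qed
qed

lemma morph_h3: "morph h3 (f5_iter n) = morph h12 (f5_iter (n + 3))"
proof -
  have "morph h3 x = morph h12 (morph f5 (morph f5 (morph f5 x)))" for x
    by (induction x) (simp_all add: h3_def)
  then show ?thesis by (simp add: numeral_eq_Suc)
qed

lemma in_L_iff: "x \<in> L \<longleftrightarrow> (\<exists>n. sublist x (morph h12 (f5_iter n)))"
proof -
  interpret desubstitution L h3 "{[B0, B0, B1, B1]}" 21 by (rule desubstitution_h3)
  show ?thesis
  proof
    assume "x \<in> L"
    then obtain y where y: "y \<in> preimage h3 {[B0, B0, B1, B1]} L" "sublist x (morph h3 y)"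
      by (rule cover)
    then obtain n where "sublist y (f5_iter n)" using factor_f5_iter b5_like_preimage by blast
    then have "sublist x (morph h3 (f5_iter n))"
      using y sublist_morph sublist_order.order.trans by blast
    then show "\<exists>n. sublist x (morph h12 (f5_iter n))" unfolding morph_h3 by blast
  next
    assume "\<exists>n. sublist x (morph h12 (f5_iter n))"
    then obtain n where n: "sublist x (morph h12 (f5_iter n))" by blast
    \<comment> \<open>Passing to an iterate three steps later turns the image under
      \<open>h12\<close> into one under \<open>h3\<close>.\<close>
    have "sublist (morph h12 (f5_iter n)) (morph h12 (f5_iter (n + 3)))"
      using prefix_f5_iter[of n "n + 3"] prefix_morph prefix_imp_sublist by (metis le_add1)
    then have "sublist x (morph h3 (f5_iter n))"
      using n sublist_order.order.trans unfolding morph_h3 by blast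
    moreover have "morph h3 (f5_iter n) \<in> L"
      using morph_preimage f5_iter_in_b5_like[OF b5_like_preimage] by blast
    ultimately show "x \<in> L" using language_sublist[OF language] by blast
  qed
qed

end

section \<open>Factors of the infinite words\<close>

lemma factors_inf_h12_b5:
  "x \<in> factors_inf (morph_inf h12 b5) \<longleftrightarrow> (\<exists>n. sublist x (morph h12 (f5_iter n)))"
proof -
  let ?W = "morph_inf h12 b5"
  have W: "map ?W [0..<length (morph h12 (f5_iter n))] = morph h12 (f5_iter n)" for n
  proof (rule nth_equalityI)
    fix i assume "i < length (map ?W [0..<length (morph h12 (f5_iter n))])"
    then have i: "i < length (morph h12 (map b5 [0..<length (f5_iter n)]))"
      by (simp add: f5_fixed_point_prefix[OF b5_fixed_point])
    show "map ?W [0..<length (morph h12 (f5_iter n))] ! i = morph h12 (f5_iter n) ! i"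
      using morph_inf_nth[OF i] i by (simp add: f5_fixed_point_prefix[OF b5_fixed_point])
  qed simp
  show ?thesis
  proof
    assume "x \<in> factors_inf ?W"
    then obtain i m where x: "x = map (\<lambda>k. ?W (i + k)) [0..<m]" by (auto simp: factors_inf_def)
    \<comment> \<open>\<open>h12\<close> alone may shorten a word, but \<open>h12\<close> after
      three applications of \<open>f5\<close> does not; three extra iterations thus reach beyond
      position \<open>i + m\<close>.\<close>
    let ?n = "Suc (Suc (Suc (i + m)))"
    have len: "i + m < length (morph h12 (f5_iter ?n))"
      using length_f5_iter[of "i + m"] length_h12_f5[of "f5_iter (i + m)"] by simp
    have "x = take m (drop i (map ?W [0..<length (morph h12 (f5_iter ?n))]))"
      unfolding x using len by (intro nth_equalityI) (auto simp del: f5_iter_simps)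
    then have "sublist x (morph h12 (f5_iter ?n))"
      unfolding W using sublist_take sublist_drop sublist_order.order.trans by metis
    then show "\<exists>n. sublist x (morph h12 (f5_iter n))" by blast
  next
    assume "\<exists>n. sublist x (morph h12 (f5_iter n))"
    then obtain n u v where n: "morph h12 (f5_iter n) = u @ x @ v" by (auto simp: sublist_def)
    have "x = map (\<lambda>k. ?W (length u + k)) [0..<length x]"
    proof (rule nth_equalityI)
      fix k assume k: "k < length x"
      then have "(u @ x @ v) ! (length u + k) = ?W (length u + k)"
        using W[of n] nth_map_upt[of "length u + k" "length (u @ x @ v)" 0 ?W] unfolding n by simp
      then show "x ! k = map (\<lambda>k. ?W (length u + k)) [0..<length x] ! k"
        using k by (simp add: nth_append)
    qed simp
    then show "x \<in> factors_inf ?W" unfolding factors_inf_def by blast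
  qed
qed

lemma language_factors_biinf: "language (factors_biinf w)"
  unfolding language_def
proof (intro conjI ballI allI impI)
  show "[] \<in> factors_biinf w" by (auto simp: factors_biinf_def)
next
  fix x y assume "x \<in> factors_biinf w" "sublist y x"
  obtain i n where x1: "x = map (\<lambda>k. w (i + int k)) [0..<n]"
    using \<open>x \<in> factors_biinf w\<close> by (auto simp: factors_biinf_def)
  obtain u v where x2: "x = u @ y @ v"
    using \<open>sublist y x\<close> by (auto simp: sublist_def)
  have "y = map (\<lambda>k. w (i + int (length u) + int k)) [0..<length y]"
  proof (rule nth_equalityI)
    fix k assume k: "k < length y"
    have "length u + k < length x" using k by (simp add: x2)
    then have "x ! (length u + k) = w (i + int (length u + k))" by (simp add: x1)
    then show "y ! k = map (\<lambda>k. w (i + int (length u) + int k)) [0..<length y] ! k"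
      using k by (simp add: x2 nth_append add.assoc)
  qed simp
  then show "y \<in> factors_biinf w" unfolding factors_biinf_def by blast
next
  fix x assume "x \<in> factors_biinf w"
  then obtain i n where x: "x = map (\<lambda>k. w (i + int k)) [0..<n]" by (auto simp: factors_biinf_def)
  have "[0..<Suc (Suc n)] = 0 # map Suc [0..<n] @ [Suc n]"
    by (simp add: map_Suc_upt upt_conv_Cons)
  then have "map (\<lambda>k. w (i - 1 + int k)) [0..<Suc (Suc n)] = w (i - 1) # x @ [w (i + int n)]"
    by (simp add: x comp_def)
  then have "w (i - 1) # x @ [w (i + int n)] \<in> factors_biinf w"
    unfolding factors_biinf_def by (intro CollectI exI[of _ "i - 1"] exI[of _ "Suc (Suc n)"]) simp
  then show "\<exists>a b. a # x @ [b] \<in> factors_biinf w" by blast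
qed

theorem theorem8:
  fixes w :: "int \<Rightarrow> bit"
  assumes "{x \<in> factors_biinf w. overlap x} = {[B0, B1, B0, B1, B0]}"
    and "finite {x \<in> factors_biinf w. square x}"
    and "card {x \<in> factors_biinf w. square x} \<le> 12"
  shows "factors_biinf w = factors_inf (morph_inf h12 b5)"
proof -
  let ?L = "factors_biinf w"
  let ?R = "{u. u \<noteq> [] \<and> u @ u \<in> ?L}"
  have squares: "{x \<in> ?L. square x} = (\<lambda>u. u @ u) ` ?R" by (auto simp: square_def)
  \<comment> \<open>A square determines its root, so the bound on squares is a bound on
    roots.\<close>
  have inj: "inj_on (\<lambda>u. u @ u) ?R" 
  proof (rule inj_onI)
    fix u v :: "bit list" assume "u @ u = v @ v"
    then have "length (u @ u) = length (v @ v)" by (rule arg_cong)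
    then have "length u = length v" by simp
    then show "u = v" using \<open>u @ u = v @ v\<close> by simp
  qed
  interpret twelve_squares ?L
  proof
    show "language ?L" by (rule language_factors_biinf)
    show "x = [B0, B1, B0, B1, B0]" if "x \<in> ?L" "overlap x" for x using assms(1) that by blast
    show "finite ?R" using assms(2) inj unfolding squares by (rule finite_imageD)
    show "card ?R \<le> 12" using assms(3) card_image[OF inj] unfolding squares by simp
    show "[B0, B1, B0, B1, B0] \<in> ?L" using assms(1) by blast
  qed
  show ?thesis using in_L_iff factors_inf_h12_b5 by blast
qed

end
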